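(* Let $q$ be an odd prime power, $d\ge2$, $Q$ a nondegenerate quadratic form on $\mathbb F_q^d$, and let $\Omega$ be the family of all $q^{d+1}$ parametrized $Q$-spheres. Let $P\subseteq\mathbb F_q^d$ be nonempty, put $n=|P|$, let $\varnothing\ne\mathcal S\subsetneq\Omega$, put $s=|\mathcal S|$, and write $$M=|\Omega|=q^{d+1},\qquad\alpha=q^d-q^{d-1},\qquad\Delta=\sqrt{\alpha ns(1-s/M)}.$$ Suppose $0\le\delta<1$ and $$|\sigma(P,\mathcal S)|\ge(1-\delta)\Delta.$$ Let $\epsilon=\operatorname{sgn}\sigma(P,\mathcal S)$. Then $$\sum_{T\in\Omega}\left(\frac{|P\cap T|-n/q}{\sqrt{\alpha n}}-\epsilon\,\frac{\mathbf 1_{\mathcal S}(T)-s/M}{\sqrt{s(1-s/M)}}\right)^2\le2\delta$$ and $$\sum_{x\in\mathbb F_q^d}\left(\frac{\mathbf 1_P(x)}{\sqrt n}-\epsilon\,\frac{d_{\mathcal S}(x)-s/q}{\sqrt{\alpha s(1-s/M)}}\right)^2\le2\delta.$$ In particular, equality $|\sigma(P,\mathcal S)|=\Delta$ holds if and only if the following equivalent two-level identities hold: $$|P\cap T|-\frac nq=\epsilon\sqrt{\frac{\alpha n}{s(1-s/M)}}\left(\mathbf 1_{\mathcal S}(T)-\frac sM\right)\quad(T\in\Omega),$$ $$d_{\mathcal S}(x)-\frac sq=\epsilon\sqrt{\frac{\alpha s(1-s/M)}n}\,\mathbf 1_P(x)\quad(x\in\mathbb F_q^d);$$ that is, equality is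 equivalent to the first identity and also equivalent to the second.
   Context: For $c\in\mathbb F_q^d$, $r\in\mathbb F_q$ the $Q$-sphere is $S_Q(c,r)=\{x\in\mathbb F_q^d:Q(x-c)=r\}$ (radius zero included); spheres are parametrized by pairs $(c,r)$ and distinct spheres means distinct parameter pairs. $\sigma(P,\mathcal S)=|\{(p,S)\in P\times\mathcal S:p\in S\}|-|P||\mathcal S|/q$. For $x\in\mathbb F_q^d$, $d_{\mathcal S}(x)=|\{S\in\mathcal S:x\in S\}|$. $\mathbf 1_A$ denotes an indicator function. *)

theory Defs
  imports "HOL-Analysis.Analysis"
begin

text \<open>The space $F_q^d$ is \<open>'a^'d\<close>, with \<open>'a\<close> a finite field, so $q$ is \<open>CARD('a)\<close> and $d$ is
  \<open>CARD('d)\<close>.\<close>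

definition polar_form :: "('a::field^'d \<Rightarrow> 'a) \<Rightarrow> 'a^'d \<Rightarrow> 'a^'d \<Rightarrow> 'a" where
  "polar_form Q x y = Q (x + y) - Q x - Q y"

definition quadratic_form :: "('a::field^'d \<Rightarrow> 'a) \<Rightarrow> bool" where
  "quadratic_form Q \<longleftrightarrow>
     (\<forall>a x. Q (a *s x) = a\<^sup>2 * Q x) \<and>
     (\<forall>y. Vector_Spaces.linear (*s) (*) (\<lambda>x. polar_form Q x y)) \<and>
     (\<forall>x. Vector_Spaces.linear (*s) (*) (\<lambda>y. polar_form Q x y))"

text \<open>Trivial radical of the polar form; this is the usual notion of nondegeneracy only in
  characteristic different from 2.\<close>

definition nondegenerate_form :: "('a::field^'d \<Rightarrow> 'a) \<Rightarrow> bool" where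
  "nondegenerate_form Q \<longleftrightarrow> (\<forall>x. (\<forall>y. polar_form Q x y = 0) \<longrightarrow> x = 0)"

text \<open>A family of spheres is a set of parameter pairs \<open>(c, r)\<close>; \<open>Q_sphere Q\<close> sends a pair to its
  point set. Different pairs count as different spheres even if their point sets coincide.\<close>

definition Q_sphere :: "('a::field^'d \<Rightarrow> 'a) \<Rightarrow> ('a^'d) \<times> 'a \<Rightarrow> ('a^'d) set" where
  "Q_sphere Q = (\<lambda>(c, r). {x. Q (x - c) = r})"

definition sphere_degree ::
    "('a::field^'d \<Rightarrow> 'a) \<Rightarrow> (('a^'d) \<times> 'a) set \<Rightarrow> 'a^'d \<Rightarrow> nat" where
  "sphere_degree Q S x = card {T \<in> S. x \<in> Q_sphere Q T}"

definition incidence_discrepancy ::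
    "('a::{field,finite}^'d \<Rightarrow> 'a) \<Rightarrow> ('a^'d) set \<Rightarrow> (('a^'d) \<times> 'a) set \<Rightarrow> real" where
  "incidence_discrepancy Q P S =
     real (card {(p, T) \<in> P \<times> S. p \<in> Q_sphere Q T})
       - real (card P) * real (card S) / real CARD('a)"

end

theory Submission
  imports Defs
begin

text \<open>
  Let \<open>A(x, T) = [x \<in> T] - 1/q\<close>. For \<open>x \<noteq> y\<close> the condition \<open>Q (x - c) = Q (y - c)\<close> cuts out an
  affine hyperplane of centres \<open>c\<close>, since the two copies of \<open>Q c\<close> cancel; hence the rows of \<open>A\<close>
  are pairwise orthogonal, of squared norm \<open>\<alpha>\<close>, and sum to zero. Both sums in the theorem are
  squared distances between vectors of norm at most 1 whose inner product is
  \<open>\<bar>\<sigma>\<bar> / \<Delta> \<ge> 1 - \<delta>\<close>.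
\<close>

section \<open>Near-equality and equality in the Cauchy-Schwarz inequality\<close>

lemma sum_square_normalized_diff_le:
  fixes f g :: "'i::finite \<Rightarrow> real"
  assumes f: "(\<Sum>i\<in>UNIV. (f i)\<^sup>2) \<le> a" and g: "(\<Sum>i\<in>UNIV. (g i)\<^sup>2) \<le> b"
    and a: "a > 0" and b: "b > 0"
    and large: "\<bar>\<Sum>i\<in>UNIV. f i * g i\<bar> \<ge> (1 - \<delta>) * sqrt (a * b)"
    and e: "e = sgn (\<Sum>i\<in>UNIV. f i * g i)"
  shows "(\<Sum>i\<in>UNIV. (f i / sqrt a - e * (g i / sqrt b))\<^sup>2) \<le> 2 * \<delta>"
proof -
  define c where "c = (\<Sum>i\<in>UNIV. f i * g i)"
  \<comment> \<open>Expanding leaves two norm terms, each at most 1, and a cross term of at least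
    \<open>2 * (1 - \<delta>)\<close>. The norms enter through upper bounds so that the degree
    vector is covered, whose norm is bounded but not computed.\<close>
  have "(f i / sqrt a - e * (g i / sqrt b))\<^sup>2
      = (f i)\<^sup>2 / a + e\<^sup>2 * (g i)\<^sup>2 / b - 2 * e / sqrt (a * b) * (f i * g i)" for i
    using a b by (simp add: power2_diff power_mult_distrib power_divide real_sqrt_mult)
  then have expand: "(\<Sum>i\<in>UNIV. (f i / sqrt a - e * (g i / sqrt b))\<^sup>2)
      = (\<Sum>i\<in>UNIV. (f i)\<^sup>2) / a + e\<^sup>2 * (\<Sum>i\<in>UNIV. (g i)\<^sup>2) / b - 2 * e / sqrt (a * b) * c"
    by (simp add: sum.distrib sum_subtractf sum_distrib_left sum_divide_distrib c_def)
  have "(\<Sum>i\<in>UNIV. (f i)\<^sup>2) / a \<le> 1"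
    using f a by simp
  moreover have "e\<^sup>2 * (\<Sum>i\<in>UNIV. (g i)\<^sup>2) / b \<le> 1"
  proof -
    \<comment> \<open>An inequality, since \<open>e = 0\<close> if the inner product
      vanishes.\<close>
    have "e\<^sup>2 \<le> 1" by (simp add: e sgn_if)
    then have "e\<^sup>2 * (\<Sum>i\<in>UNIV. (g i)\<^sup>2) \<le> 1 * b"
      using g b by (intro mult_mono) (auto intro: sum_nonneg)
    then show ?thesis using b by simp
  qed
  moreover have "2 * e / sqrt (a * b) * c \<ge> 2 * (1 - \<delta>)"
  proof -
    have "e * c = \<bar>c\<bar>" by (simp add: e c_def abs_sgn mult.commute)
    moreover have "sqrt (a * b) > 0" using a b by simp
    moreover have "2 * e / sqrt (a * b) * c = 2 * (e * c) / sqrt (a * b)" by simp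
    ultimately show ?thesis
      using large by (simp only: c_def[symmetric] pos_le_divide_eq)
  qed
  moreover have "A + B - C \<le> 2 * \<delta>" if "A \<le> 1" "B \<le> 1" "C \<ge> 2 * (1 - \<delta>)" for A B C
    using that by simp
  ultimately show ?thesis unfolding expand by blast
qed

text \<open>Equality is the case \<delta> = 0 of the previous bound: a vanishing sum of squares
  forces every term to vanish, and \<open>e * e = 1\<close> solves for \<open>g\<close>. The exact
  norm is asked of \<open>f\<close> because the converse substitutes the multiple of
  \<open>f\<close> for \<open>g\<close> and evaluates the inner product through that norm.\<close>

lemma abs_sum_mult_eq_sqrt_iff:
  fixes f g :: "'i::finite \<Rightarrow> real"
  assumes f: "(\<Sum>i\<in>UNIV. (f i)\<^sup>2) = a" and g: "(\<Sum>i\<in>UNIV. (g i)\<^sup>2) \<le> b"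
    and a: "a > 0" and b: "b > 0"
    and nz: "(\<Sum>i\<in>UNIV. f i * g i) \<noteq> 0"
    and e: "e = sgn (\<Sum>i\<in>UNIV. f i * g i)"
  shows "\<bar>\<Sum>i\<in>UNIV. f i * g i\<bar> = sqrt (a * b) \<longleftrightarrow> (\<forall>i. g i = e * sqrt (b / a) * f i)"
proof
  assume eq: "\<bar>\<Sum>i\<in>UNIV. f i * g i\<bar> = sqrt (a * b)"
  have e1: "e * e = 1" using nz by (simp add: e sgn_if)
  have "(\<Sum>i\<in>UNIV. (f i / sqrt a - e * (g i / sqrt b))\<^sup>2) \<le> 2 * 0"
    using f g a b eq e by (intro sum_square_normalized_diff_le) auto
  then have "(\<Sum>i\<in>UNIV. (f i / sqrt a - e * (g i / sqrt b))\<^sup>2) = 0"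
    by (smt (verit) sum_nonneg zero_le_power2)
  then have z: "f i / sqrt a = e * (g i / sqrt b)" for i
    by (simp add: sum_nonneg_eq_0_iff)
  show "\<forall>i. g i = e * sqrt (b / a) * f i"
  proof
    fix i
    have "e * sqrt (b / a) * f i = e * sqrt b * (f i / sqrt a)"
      by (simp add: real_sqrt_divide)
    also have "\<dots> = (e * e) * g i"
      using b by (simp add: z)
    finally show "g i = e * sqrt (b / a) * f i" using e1 by simp
  qed
next
  assume eq: "\<forall>i. g i = e * sqrt (b / a) * f i"
  have "(\<Sum>i\<in>UNIV. f i * g i) = e * sqrt (b / a) * (\<Sum>i\<in>UNIV. (f i)\<^sup>2)"
    unfolding sum_distrib_left by (rule sum.cong) (simp_all add: eq[rule_format] power2_eq_square)
  also have "\<dots> = e * (sqrt (b / a) * a)" by (simp add: f)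
  also have "sqrt (b / a) * a = sqrt (a * b)"
    using a b by (simp add: real_sqrt_divide real_sqrt_mult field_simps)
  finally have "(\<Sum>i\<in>UNIV. f i * g i) = e * sqrt (a * b)" .
  moreover have "\<bar>e\<bar> = 1" using nz by (simp add: e sgn_if)
  ultimately show "\<bar>\<Sum>i\<in>UNIV. f i * g i\<bar> = sqrt (a * b)"
    using a b by (simp add: abs_mult)
qed

section \<open>Matrices with pairwise orthogonal rows of equal norm\<close>

lemma sum_square_transpose_apply:
  fixes A :: "'x::finite \<Rightarrow> 't::finite \<Rightarrow> real"
  assumes orth: "\<And>x y. (\<Sum>t\<in>UNIV. A x t * A y t) = (if x = y then a else 0)"
  shows "(\<Sum>t\<in>UNIV. (\<Sum>x\<in>UNIV. u x * A x t)\<^sup>2) = a * (\<Sum>x\<in>UNIV. (u x)\<^sup>2)"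
proof -
  have "(\<Sum>t\<in>UNIV. (\<Sum>x\<in>UNIV. u x * A x t)\<^sup>2)
      = (\<Sum>t\<in>UNIV. \<Sum>x\<in>UNIV. \<Sum>y\<in>UNIV. u x * u y * (A x t * A y t))"
    by (simp add: power2_eq_square sum_product ac_simps)
  also have "\<dots> = (\<Sum>x\<in>UNIV. \<Sum>y\<in>UNIV. \<Sum>t\<in>UNIV. u x * u y * (A x t * A y t))"
    by (subst sum.swap, intro sum.cong refl sum.swap)
  also have "\<dots> = (\<Sum>x\<in>UNIV. \<Sum>y\<in>UNIV. u x * u y * (if x = y then a else 0))"
    by (simp add: sum_distrib_left[symmetric] orth)
  also have "\<dots> = (\<Sum>x\<in>UNIV. a * (u x)\<^sup>2)"
    by (simp add: if_distrib sum.delta power2_eq_square ac_simps cong: if_cong)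
  finally show ?thesis by (simp add: sum_distrib_left)
qed

text \<open>The transpose scales squared norms by \<open>a\<close>, and its adjoint has the same
  operator norm. Concretely, for h = Av and N = |h|^2, Cauchy-Schwarz applied to the pairing of the
  transpose image of h with v gives N^2 \<le> aN|v|^2. Equality can fail, as v may have a part
  orthogonal to all rows.\<close>

lemma sum_square_apply_le:
  fixes A :: "'x::finite \<Rightarrow> 't::finite \<Rightarrow> real"
  assumes orth: "\<And>x y. (\<Sum>t\<in>UNIV. A x t * A y t) = (if x = y then a else 0)"
  shows "(\<Sum>x\<in>UNIV. (\<Sum>t\<in>UNIV. A x t * v t)\<^sup>2) \<le> a * (\<Sum>t\<in>UNIV. (v t)\<^sup>2)"
proof -
  define h where "h x = (\<Sum>t\<in>UNIV. A x t * v t)" for x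
  define k where "k t = (\<Sum>x\<in>UNIV. h x * A x t)" for t
  define N where "N = (\<Sum>x\<in>UNIV. (h x)\<^sup>2)"
  have N0: "N \<ge> 0" by (simp add: N_def sum_nonneg)
  \<comment> \<open>\<open>a\<close> is the squared norm of any row; \<open>undefined\<close> merely
    names one. The sign settles the case \<open>N = 0\<close> below.\<close>
  have a0: "a \<ge> 0"
    using orth[of undefined undefined] by (metis (no_types, lifting) sum_nonneg zero_le_square)
  have "N = (\<Sum>x\<in>UNIV. \<Sum>t\<in>UNIV. h x * A x t * v t)"
    by (simp add: N_def power2_eq_square h_def sum_distrib_left ac_simps)
  also have "\<dots> = (\<Sum>t\<in>UNIV. k t * v t)"
    by (subst sum.swap) (simp add: k_def sum_distrib_right)
  finally have "N\<^sup>2 = (\<Sum>t\<in>UNIV. k t * v t)\<^sup>2" by simp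
  also have "\<dots> \<le> (\<Sum>t\<in>UNIV. (k t)\<^sup>2) * (\<Sum>t\<in>UNIV. (v t)\<^sup>2)"
    by (rule Cauchy_Schwarz_ineq_sum)
  also have "(\<Sum>t\<in>UNIV. (k t)\<^sup>2) = a * N"
    unfolding k_def N_def by (rule sum_square_transpose_apply[OF orth])
  finally have "N * N \<le> N * (a * (\<Sum>t\<in>UNIV. (v t)\<^sup>2))"
    by (simp add: power2_eq_square ac_simps)
  then have "N \<le> a * (\<Sum>t\<in>UNIV. (v t)\<^sup>2)"
    using N0 a0 by (cases "N = 0") (simp_all add: sum_nonneg)
  then show ?thesis by (simp add: N_def h_def)
qed

section \<open>Counting the centres at which two points have equal form value\<close>

lemma card_level_set_linear_functional:
  fixes L :: "'a::{field,finite}^'d \<Rightarrow> 'a"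
  assumes L: "Vector_Spaces.linear (*s) (*) L" and u: "L u \<noteq> 0"
  shows "CARD('a) * card {c. L c = t} = CARD('a^'d)"
proof -
  interpret L: Vector_Spaces.linear "(*s)" "(*)" L by (rule L)
  have shift: "card {c. L c = r} = card {c. L c = t}" for r
  proof (rule bij_betw_same_card)
    \<comment> \<open>Translation by \<open>w\<close> raises \<open>L\<close> by
      \<open>t - r\<close>, so all level sets have the same size; they partition the space.\<close>
    define w where "w = ((t - r) / L u) *s u"
    have w: "L w = t - r" using u by (simp add: w_def L.scale)
    show "bij_betw (\<lambda>c. c + w) {c. L c = r} {c. L c = t}"
      by (rule bij_betw_byWitness[where f' = "\<lambda>c. c - w"]) (auto simp: L.add L.diff w)
  qed
  have "CARD('a^'d) = card (\<Union>r\<in>UNIV. {c. L c = r})"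
    by (rule arg_cong[where f = card]) auto
  also have "\<dots> = (\<Sum>r\<in>UNIV. card {c. L c = r})"
    by (rule card_UN_disjoint) auto
  also have "\<dots> = (\<Sum>r\<in>(UNIV :: 'a set). card {c. L c = t})"
    by (rule sum.cong[OF refl shift])
  finally show ?thesis by simp
qed

lemma quadratic_form_diff:
  assumes Q: "quadratic_form Q"
  shows "Q (x - c) = Q x + Q c - polar_form Q x c"
proof -
  interpret B: Vector_Spaces.linear "(*s)" "(*)" "\<lambda>y. polar_form Q x y"
    using Q by (simp add: quadratic_form_def)
  have "Q ((-1) *s c) = (-1)\<^sup>2 * Q c"
    using Q unfolding quadratic_form_def by blast
  then have "Q (- c) = Q c" by simp
  then show ?thesis
    using B.neg[of c] by (simp add: polar_form_def algebra_simps)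
qed

text \<open>The centres form a level set of the linear functional
  \<open>polar_form Q (x - y)\<close>. The count is stated multiplied by q to avoid division of
  natural numbers.\<close>

lemma card_equal_form_values:
  fixes Q :: "'a::{field,finite}^'d \<Rightarrow> 'a"
  assumes Q: "quadratic_form Q" "nondegenerate_form Q" and xy: "x \<noteq> y"
  shows "CARD('a) * card {c. Q (x - c) = Q (y - c)} = CARD('a^'d)"
proof -
  \<comment> \<open>Nondegeneracy enters here: it makes the functional nonzero.\<close>
  obtain u where u: "polar_form Q (x - y) u \<noteq> 0"
    using Q(2) xy unfolding nondegenerate_form_def by (metis right_minus_eq)
  have "polar_form Q (x - y) c = polar_form Q x c - polar_form Q y c" for c
  proof -
    interpret B: Vector_Spaces.linear "(*s)" "(*)" "\<lambda>x. polar_form Q x c"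
      using Q(1) by (simp add: quadratic_form_def)
    show ?thesis by (rule B.diff)
  qed
  moreover have "Q (x - c) = Q (y - c) \<longleftrightarrow> polar_form Q x c - polar_form Q y c = Q x - Q y" for c
    unfolding quadratic_form_diff[OF Q(1)] by (auto simp: algebra_simps)
  ultimately have "{c. Q (x - c) = Q (y - c)} = {c. polar_form Q (x - y) c = Q x - Q y}"
    by simp
  moreover have "Vector_Spaces.linear (*s) (*) (polar_form Q (x - y))"
    using Q(1) by (simp add: quadratic_form_def)
  ultimately show ?thesis
    using card_level_set_linear_functional[where L = "polar_form Q (x - y)", OF _ u] by simp
qed

section \<open>The centred incidence matrix of points and spheres\<close>

definition sphere_kernel :: "('a::{field,finite}^'d \<Rightarrow> 'a) \<Rightarrow> 'a^'d \<Rightarrow> ('a^'d) \<times> 'a \<Rightarrow> real" where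
  "sphere_kernel Q x T = indicator (Q_sphere Q T) x - 1 / real CARD('a)"

lemma sum_pairs_UNIV:
  fixes f :: "'b::finite \<times> 'c::finite \<Rightarrow> real"
  shows "(\<Sum>T\<in>UNIV. f T) = (\<Sum>c\<in>UNIV. \<Sum>r\<in>UNIV. f (c, r))"
  by (simp add: sum.cartesian_product)

lemma indicator_Q_sphere:
  "indicator (Q_sphere Q (c, r)) x = (if r = Q (x - c) then 1 else 0 :: real)"
  by (auto simp: Q_sphere_def indicator_def)

text \<open>For each centre exactly one of the q radii puts \<open>x\<close> on the sphere, so
  subtracting 1/q centres every row.\<close>

lemma sum_sphere_kernel:
  fixes Q :: "'a::{field,finite}^'d \<Rightarrow> 'a"
  shows "(\<Sum>T\<in>UNIV. sphere_kernel Q x T) = 0"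
  by (simp add: sum_pairs_UNIV sphere_kernel_def indicator_Q_sphere sum_subtractf)

text \<open>Summing over radii first leaves [Q(x - c) = Q(y - c)] - 1/q for each centre c. For
  \<open>x \<noteq> y\<close> exactly a fraction 1/q of the centres satisfies the condition, so the
  total vanishes.\<close>

lemma sphere_kernel_orthogonal:
  fixes Q :: "'a::{field,finite}^'d \<Rightarrow> 'a"
  assumes Q: "quadratic_form Q" "nondegenerate_form Q"
  shows "(\<Sum>T\<in>UNIV. sphere_kernel Q x T * sphere_kernel Q y T)
    = (if x = y then real CARD('a^'d) - real CARD('a^'d) / real CARD('a) else 0)"
proof -
  let ?q = "real CARD('a)"
  have "(\<Sum>r\<in>UNIV. sphere_kernel Q x (c, r) * sphere_kernel Q y (c, r))
      = (if Q (x - c) = Q (y - c) then 1 else 0) - 1 / ?q" for c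
  proof -
    \<comment> \<open>Over the q radii the last three terms add up to -1/q - 1/q + 1/q.\<close>
    have "sphere_kernel Q x (c, r) * sphere_kernel Q y (c, r)
        = (if r = Q (x - c) then if Q (x - c) = Q (y - c) then 1 else 0 else 0)
          - (if r = Q (x - c) then 1 / ?q else 0) - (if r = Q (y - c) then 1 / ?q else 0)
          + 1 / ?q * (1 / ?q)" for r
      by (simp add: sphere_kernel_def indicator_Q_sphere algebra_simps)
    then show ?thesis
      by (simp add: sum.distrib sum_subtractf)
  qed
  then have "(\<Sum>T\<in>UNIV. sphere_kernel Q x T * sphere_kernel Q y T)
      = real (card {c. Q (x - c) = Q (y - c)}) - real CARD('a^'d) / ?q"
    by (simp add: sum_pairs_UNIV sum_subtractf sum.If_cases)
  moreover have "real (card {c. Q (x - c) = Q (y - c)}) = real CARD('a^'d) / ?q" if "x \<noteq> y"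
    using card_equal_form_values[OF Q that, THEN arg_cong[where f = real]]
    by (simp add: field_simps)
  ultimately show ?thesis by simp
qed

lemma sum_indicator_UNIV:
  fixes X :: "'b::finite set"
  shows "(\<Sum>i\<in>UNIV. indicator X i) = real (card X)"
  by (simp add: indicator_def sum.If_cases)

text \<open>Centred intersection sizes are the image of the indicator of \<open>P\<close> under the
  transposed kernel, so orthogonality computes their norm exactly.\<close>

lemma sum_indicator_mult_sphere_kernel:
  fixes Q :: "'a::{field,finite}^'d \<Rightarrow> 'a"
  shows "(\<Sum>x\<in>UNIV. indicator P x * sphere_kernel Q x T)
    = real (card (P \<inter> Q_sphere Q T)) - real (card P) / real CARD('a)"
proof -
  have "(\<Sum>x\<in>UNIV. indicator P x * sphere_kernel Q x T)
      = (\<Sum>x\<in>UNIV. indicator (P \<inter> Q_sphere Q T) x - indicator P x * (1 / real CARD('a)))"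
    by (simp add: sphere_kernel_def indicator_inter_arith algebra_simps)
  then show ?thesis
    by (simp only: sum_subtractf sum_distrib_right[symmetric] sum_indicator_UNIV) simp
qed

lemma sum_sphere_kernel_mult_indicator:
  fixes Q :: "'a::{field,finite}^'d \<Rightarrow> 'a"
  shows "(\<Sum>T\<in>UNIV. sphere_kernel Q x T * indicator S T)
    = real (sphere_degree Q S x) - real (card S) / real CARD('a)"
proof -
  have "(\<Sum>T\<in>UNIV. sphere_kernel Q x T * indicator S T)
      = (\<Sum>T\<in>UNIV. indicator {T \<in> S. x \<in> Q_sphere Q T} T - indicator S T * (1 / real CARD('a)))"
    by (intro sum.cong) (auto simp: sphere_kernel_def indicator_def)
  then show ?thesis
    by (simp only: sum_subtractf sum_distrib_right[symmetric] sum_indicator_UNIV)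
      (simp add: sphere_degree_def)
qed

text \<open>Counting incidences point by point turns the discrepancy into an inner product on the
  point space.\<close>

lemma incidence_discrepancy_eq_sum:
  fixes Q :: "'a::{field,finite}^'d \<Rightarrow> 'a"
  shows "incidence_discrepancy Q P S
    = (\<Sum>x\<in>UNIV. indicator P x * (real (sphere_degree Q S x) - real (card S) / real CARD('a)))"
proof -
  have "{(p, T) \<in> P \<times> S. p \<in> Q_sphere Q T} = Sigma P (\<lambda>p. {T \<in> S. p \<in> Q_sphere Q T})"
    by auto
  then have "real (card {(p, T) \<in> P \<times> S. p \<in> Q_sphere Q T})
      = (\<Sum>x\<in>P. real (sphere_degree Q S x))"
    by (simp add: sphere_degree_def)
  moreover have "(\<Sum>x\<in>UNIV. indicator P x * f x) = (\<Sum>x\<in>P. f x)" for f :: "'a^'d \<Rightarrow> real"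
    by (simp add: sum_indicator_mult)
  ultimately show ?thesis
    by (simp add: incidence_discrepancy_def sum_subtractf)
qed

section \<open>Stability and the two equality identities\<close>

theorem theorem2p2:
  fixes Q :: "'a::{field,finite}^'d::finite \<Rightarrow> 'a"
    and P :: "('a^'d) set"
    and S \<Omega> :: "(('a^'d) \<times> 'a) set"
    and q d :: nat
    and n s M \<alpha> \<Delta> \<sigma> \<delta> \<epsilon> :: real
  assumes q: "q = CARD('a)" "odd q"
    and d: "d = CARD('d)" "d \<ge> 2"
    and Q: "quadratic_form Q" "nondegenerate_form Q"
    and Omega: "\<Omega> = UNIV"
    and P: "P \<noteq> {}" and n: "n = real (card P)"
    and S: "S \<noteq> {}" "S \<subset> \<Omega>" and s: "s = real (card S)"
    and M: "M = real (card \<Omega>)"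
    and alpha: "\<alpha> = real q ^ d - real q ^ (d - 1)"
    and Delta: "\<Delta> = sqrt (\<alpha> * n * s * (1 - s / M))"
    and sigma: "\<sigma> = incidence_discrepancy Q P S"
    and delta: "0 \<le> \<delta>" "\<delta> < 1"
    and large: "\<bar>\<sigma>\<bar> \<ge> (1 - \<delta>) * \<Delta>"
    and epsilon: "\<epsilon> = sgn \<sigma>"
  shows "M = real q ^ (d + 1) \<and>
      ((\<Sum>T\<in>\<Omega>. ((real (card (P \<inter> Q_sphere Q T)) - n / real q) / sqrt (\<alpha> * n)
            - \<epsilon> * ((indicator S T - s / M) / sqrt (s * (1 - s / M))))\<^sup>2) \<le> 2 * \<delta>) \<and>
      ((\<Sum>x\<in>UNIV. (indicator P x / sqrt n
            - \<epsilon> * ((real (sphere_degree Q S x) - s / real q)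
                    / sqrt (\<alpha> * s * (1 - s / M))))\<^sup>2) \<le> 2 * \<delta>) \<and>
      (\<bar>\<sigma>\<bar> = \<Delta> \<longleftrightarrow>
          (\<forall>T\<in>\<Omega>. real (card (P \<inter> Q_sphere Q T)) - n / real q
             = \<epsilon> * sqrt (\<alpha> * n / (s * (1 - s / M))) * (indicator S T - s / M))) \<and>
      (\<bar>\<sigma>\<bar> = \<Delta> \<longleftrightarrow>
          (\<forall>x. real (sphere_degree Q S x) - s / real q
             = \<epsilon> * sqrt (\<alpha> * s * (1 - s / M) / n) * indicator P x))"
proof -
  define f where "f T = real (card (P \<inter> Q_sphere Q T)) - n / real q" for T
  define g :: "('a^'d) \<times> 'a \<Rightarrow> real" where "g T = indicator S T - s / M" for T
  define h where "h x = real (sphere_degree Q S x) - s / real q" for x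
  define A where "A = sphere_kernel Q"
  define b where "b = s * (1 - s / M)"
  have q1: "real q > 1"
  proof -
    have "card {0, 1 :: 'a} \<le> CARD('a)" by (rule card_mono) auto
    then show ?thesis by (simp add: q)
  qed
  have cardV: "real CARD('a^'d) = real q ^ d"
    by (simp add: q d)
  have Mq: "M = real q ^ (d + 1)"
    using cardV by (simp add: M Omega q(1) d(1) card_cartesian_product flip: UNIV_Times_UNIV)
  have alpha_eq: "\<alpha> = real CARD('a^'d) - real CARD('a^'d) / real CARD('a)"
    using q1 d(2) unfolding cardV by (simp add: alpha q(1)[symmetric] power_diff)
  have alpha0: "\<alpha> > 0"
    using q1 d(2) by (simp add: alpha)
  have n0: "n > 0" using P by (simp add: n card_gt_0_iff)
  have s0: "s > 0" using S(1) by (simp add: s card_gt_0_iff)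
  have sM: "s < M" using S(2) unfolding s M by (simp only: of_nat_less_iff) (rule psubset_card_mono[OF finite])
  have b0: "b > 0" using s0 sM by (simp add: b_def)
  have orth: "(\<Sum>T\<in>UNIV. A x T * A y T) = (if x = y then \<alpha> else 0)" for x y
    unfolding A_def alpha_eq by (rule sphere_kernel_orthogonal[OF Q])
  have f_eq: "f T = (\<Sum>x\<in>UNIV. indicator P x * A x T)" for T
    by (simp add: f_def A_def sum_indicator_mult_sphere_kernel n q(1))
  \<comment> \<open>Rows of \<open>A\<close> sum to zero, so centring the indicator of
    \<open>S\<close> leaves its image unchanged while reducing its squared norm from
    \<open>s\<close> to \<open>b\<close>. This is the source of the factor \<open>1 - s / M\<close>
    in \<open>\<Delta>\<close>.\<close>
  have h_eq: "h x = (\<Sum>T\<in>UNIV. A x T * g T)" for x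
  proof -
    have "(\<Sum>T\<in>UNIV. A x T * g T) = (\<Sum>T\<in>UNIV. A x T * indicator S T) - (\<Sum>T\<in>UNIV. A x T) * (s / M)"
      by (simp add: g_def right_diff_distrib sum_subtractf sum_distrib_right
          sum_divide_distrib)
    then show ?thesis
      by (simp add: h_def A_def sum_sphere_kernel_mult_indicator sum_sphere_kernel s q(1))
  qed
  have ind2: "(\<Sum>i\<in>UNIV. (indicator X i :: real)\<^sup>2) = real (card X)" for X :: "'b::finite set"
    using sum_indicator_UNIV[of X] by (simp add: indicator_def power2_eq_square)
  have norm_f: "(\<Sum>T\<in>UNIV. (f T)\<^sup>2) = \<alpha> * n"
    using sum_square_transpose_apply[OF orth, of "indicator P"] by (simp add: f_eq ind2 n)
  have norm_g: "(\<Sum>T\<in>UNIV. (g T)\<^sup>2) = b"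
  proof -
    have "(g T)\<^sup>2 = (1 - 2 * (s / M)) * indicator S T + (s / M)\<^sup>2" for T
      by (simp add: g_def indicator_def power2_eq_square algebra_simps)
    then have "(\<Sum>T\<in>UNIV. (g T)\<^sup>2) = (1 - 2 * (s / M)) * s + M * (s / M)\<^sup>2"
      by (simp only: sum.distrib sum_distrib_left[symmetric] sum_indicator_UNIV s M Omega) simp
    also have "\<dots> = b"
      using s0 sM by (simp add: b_def field_simps power2_eq_square)
    finally show ?thesis .
  qed
  have norm_h: "(\<Sum>x\<in>UNIV. (h x)\<^sup>2) \<le> \<alpha> * b"
    unfolding h_eq norm_g[symmetric] by (rule sum_square_apply_le[OF orth])
  have sigma_h: "(\<Sum>x\<in>UNIV. indicator P x * h x) = \<sigma>"
    by (simp add: sigma incidence_discrepancy_eq_sum h_def s q(1))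
  \<comment> \<open>Both inner products are the bilinear form of \<open>A\<close> at the indicator
    of \<open>P\<close> and \<open>g\<close>, summed in either order.\<close>
  have sigma_f: "(\<Sum>T\<in>UNIV. f T * g T) = \<sigma>"
    unfolding sigma_h[symmetric] f_eq h_eq sum_distrib_left sum_distrib_right
    by (subst sum.swap) (simp add: mult.assoc)
  have sigma_g: "(\<Sum>T\<in>UNIV. g T * f T) = \<sigma>"
    using sigma_f by (simp add: mult.commute)
  have Delta_f: "\<Delta> = sqrt (\<alpha> * n * b)" and Delta_g: "\<Delta> = sqrt (b * (\<alpha> * n))"
    and Delta_h: "\<Delta> = sqrt (n * (\<alpha> * b))"
    by (simp_all add: Delta b_def ac_simps)
  \<comment> \<open>Since \<delta> < 1, the discrepancy is nonzero and \<open>\<epsilon>\<close> is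
    1 or -1, as the equality criterion requires.\<close>
  have "\<Delta> > 0" using alpha0 n0 b0 by (simp add: Delta_f)
  then have nz: "\<sigma> \<noteq> 0" using large delta by (smt (verit) mult_pos_pos)
  have ab: "\<alpha> * s * (1 - s / M) = \<alpha> * b" by (simp add: b_def)
  have "(\<Sum>T\<in>\<Omega>. (f T / sqrt (\<alpha> * n) - \<epsilon> * (g T / sqrt b))\<^sup>2) \<le> 2 * \<delta>"
    unfolding Omega using norm_f norm_g alpha0 n0 b0 large epsilon
    by (intro sum_square_normalized_diff_le) (simp_all add: sigma_f Delta_f)
  moreover have "(\<Sum>x\<in>UNIV. (indicator P x / sqrt n - \<epsilon> * (h x / sqrt (\<alpha> * b)))\<^sup>2) \<le> 2 * \<delta>"
    using norm_h alpha0 n0 b0 large epsilon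
    by (intro sum_square_normalized_diff_le) (simp_all add: sigma_h Delta_h ind2 n)
  \<comment> \<open>The criterion is solved for its second vector, so \<open>g\<close> comes first
    here, and the indicator of \<open>P\<close> comes first for \<open>h\<close> below.\<close>
  moreover have "\<bar>\<sigma>\<bar> = \<Delta> \<longleftrightarrow> (\<forall>T\<in>\<Omega>. f T = \<epsilon> * sqrt (\<alpha> * n / b) * g T)"
    using abs_sum_mult_eq_sqrt_iff[of g b f "\<alpha> * n" \<epsilon>] norm_f norm_g alpha0 n0 b0 nz epsilon
    by (simp add: sigma_g Delta_g Omega)
  moreover have "\<bar>\<sigma>\<bar> = \<Delta> \<longleftrightarrow> (\<forall>x. h x = \<epsilon> * sqrt (\<alpha> * b / n) * indicator P x)"
    using abs_sum_mult_eq_sqrt_iff[of "indicator P" n h "\<alpha> * b" \<epsilon>] norm_h alpha0 n0 b0 nz epsilon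
    by (simp add: sigma_h Delta_h ind2 n)
  ultimately show ?thesis
    unfolding ab f_def g_def h_def b_def[symmetric] using Mq by blast
qed

end
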